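(* Let $\kappa$ be a regular infinite cardinal and let $l=(\Sigma,X,\vdash)$ be a logic of cardinality at most $\kappa$. For each $\Sigma$-structure $A$ let $Fi_l(A)$ be the set of $l$-filters on $A$ ordered by inclusion, for each homomorphism $h\colon A'\to A$ let $Fi_l(h)=h^{-1}\colon Fi_l(A)\to Fi_l(A')$, and let $i_A\colon Fi_l(A)\hookrightarrow\wp(A)$ be the inclusion. Then $(Fi_l,i)$ is a well-defined $\kappa$-filter pair over $\Sigma$.
   Context: A logic $(\Sigma,X,\vdash)$ consists of a signature $\Sigma$ (a sequence of sets of $n$-ary operation symbols), an infinite set $X$ of variables and a relation $\vdash\subseteq\wp(Fm_\Sigma(X))\times Fm_\Sigma(X)$ on the absolutely free $\Sigma$-algebra $Fm_\Sigma(X)$ that is reflexive, satisfies cut, is monotone, and is structural (closed under all endomorphisms of $Fm_\Sigma(X)$). It has cardinality at most $\kappa$ if whenever $\Gamma\vdash\varphi$ there is $\Gamma'\subseteq\Gamma$ with $|\Gamma'|<\kappa$ and $\Gamma'\vdash\varphi$. An $l$-filter on a $\Sigma$-algebra $A$ is a subset $F\subseteq A$ such that for all $\Gamma\cup\{\varphi\}\subseteq Fm_\Sigma(X)$ with $\Gamma\vdash\varphi$ and every homomorphism $v\colon Fm_\Sigma(X)\to A$, $v(\Gamma)\subseteq F$ implies $v(\varphi)\in F$. For regular $\kappa$: a subset of a poset is $\kappa$-directed if each subset of it of size $<\kappa$ has an upper bound in it; $x$ is $\kappa$-small if for every $\kappa$-directed $D$, $x\le\sup D$ iff $x\le d$ for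 some $d\in D$; a $\kappa$-presentable lattice is a complete lattice where every element is a supremum of $\kappa$-small elements; $L_\kappa$ is the category of these with order-preserving maps. A $\kappa$-filter pair over $\Sigma$ is a pair $(G,i)$ with $G\colon\Sigma\text{-str}^{op}\to L_\kappa$ a functor and order preserving maps $i_M\colon G(M)\to\wp(M)$ preserving arbitrary infima and $\kappa$-directed suprema, such that $i_M\circ G(h)=h^{-1}\circ i_N$ for all homomorphisms $h\colon M\to N$. *)

theory Defs
  imports "HOL-Algebra.Complete_Lattice" "HOL-Library.FuncSet"
begin

unbundle cardinal_syntax

section \<open>Signatures, structures and formulas\<close>

text \<open>
  A signature is a sequence of sets \<open>\<Sigma> :: nat \<Rightarrow> 'f set\<close>, where \<open>\<Sigma> n\<close> contains the \<open>n\<close>-ary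
  operation symbols. The interpretation takes a symbol together with the list of its arguments; the
  arity at which the symbol is used is the length of that list, so the sets \<open>\<Sigma> n\<close> need not be
  disjoint. Carriers are sets in a type and may be empty.
\<close>

record ('f, 'a) raw_structure = "'a partial_object" +
  interp :: "'f \<Rightarrow> 'a list \<Rightarrow> 'a"

definition sig_structure :: "(nat \<Rightarrow> 'f set) \<Rightarrow> ('f, 'a) raw_structure \<Rightarrow> bool" where
  "sig_structure \<Sigma> M \<longleftrightarrow>
     (\<forall>n. \<forall>f\<in>\<Sigma> n. \<forall>xs. length xs = n \<and> set xs \<subseteq> carrier M \<longrightarrow> interp M f xs \<in> carrier M)"

text \<open>
  Morphisms are extensional functions, so that equal functions on the carrier are equal in HOL;
  their composition is \<^const>\<open>compose\<close> and identities are restricted to the carrier.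
\<close>

definition str_hom ::
    "(nat \<Rightarrow> 'f set) \<Rightarrow> ('f, 'a) raw_structure \<Rightarrow> ('f, 'b) raw_structure \<Rightarrow> ('a \<Rightarrow> 'b) set" where
  "str_hom \<Sigma> M N =
     {h \<in> carrier M \<rightarrow>\<^sub>E carrier N.
        \<forall>n. \<forall>f\<in>\<Sigma> n. \<forall>xs. length xs = n \<and> set xs \<subseteq> carrier M \<longrightarrow>
          h (interp M f xs) = interp N f (map h xs)}"

datatype ('f, 'x) fm = Var 'x | Op 'f "('f, 'x) fm list"

inductive_set Fm :: "(nat \<Rightarrow> 'f set) \<Rightarrow> 'x set \<Rightarrow> ('f, 'x) fm set"
  for \<Sigma> :: "nat \<Rightarrow> 'f set" and X :: "'x set" where
  Var: "x \<in> X \<Longrightarrow> Var x \<in> Fm \<Sigma> X"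
| Op: "f \<in> \<Sigma> (length ts) \<Longrightarrow> (\<forall>t\<in>set ts. t \<in> Fm \<Sigma> X) \<Longrightarrow> Op f ts \<in> Fm \<Sigma> X"

definition Fm_alg :: "(nat \<Rightarrow> 'f set) \<Rightarrow> 'x set \<Rightarrow> ('f, ('f, 'x) fm) raw_structure" where
  "Fm_alg \<Sigma> X = \<lparr>carrier = Fm \<Sigma> X, interp = Op\<rparr>"

section \<open>Logics and their filters\<close>

text \<open>The consequence relation is a set of pairs: \<open>(\<Gamma>, \<phi>) \<in> C\<close> stands for \<open>\<Gamma> \<turnstile> \<phi>\<close>.\<close>

locale logic =
  fixes \<Sigma> :: "nat \<Rightarrow> 'f set"
    and X :: "'x set"
    and C :: "(('f, 'x) fm set \<times> ('f, 'x) fm) set"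
  assumes infinite_vars: "infinite X"
    and consequence: "C \<subseteq> Pow (Fm \<Sigma> X) \<times> Fm \<Sigma> X"
    and reflexive: "\<lbrakk>\<Gamma> \<subseteq> Fm \<Sigma> X; \<phi> \<in> \<Gamma>\<rbrakk> \<Longrightarrow> (\<Gamma>, \<phi>) \<in> C"
    and cut: "\<lbrakk>\<Delta> \<subseteq> Fm \<Sigma> X; (\<Gamma>, \<phi>) \<in> C; \<And>\<psi>. \<psi> \<in> \<Gamma> \<Longrightarrow> (\<Delta>, \<psi>) \<in> C\<rbrakk> \<Longrightarrow> (\<Delta>, \<phi>) \<in> C"
    and monotone: "\<lbrakk>\<Delta> \<subseteq> Fm \<Sigma> X; (\<Gamma>, \<phi>) \<in> C; \<Gamma> \<subseteq> \<Delta>\<rbrakk> \<Longrightarrow> (\<Delta>, \<phi>) \<in> C"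
    and structural: "\<lbrakk>(\<Gamma>, \<phi>) \<in> C; \<sigma> \<in> str_hom \<Sigma> (Fm_alg \<Sigma> X) (Fm_alg \<Sigma> X)\<rbrakk>
                       \<Longrightarrow> (\<sigma> ` \<Gamma>, \<sigma> \<phi>) \<in> C"

text \<open>Cardinals are represented, as in the library, by relations \<open>\<kappa>\<close> with \<open>Card_order \<kappa>\<close>.\<close>

definition logic_card_le :: "'k rel \<Rightarrow> (('f, 'x) fm set \<times> ('f, 'x) fm) set \<Rightarrow> bool" where
  "logic_card_le \<kappa> C \<longleftrightarrow> (\<forall>(\<Gamma>, \<phi>)\<in>C. \<exists>\<Gamma>'\<subseteq>\<Gamma>. |\<Gamma>'| <o \<kappa> \<and> (\<Gamma>', \<phi>) \<in> C)"

definition l_filter ::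
    "(nat \<Rightarrow> 'f set) \<Rightarrow> 'x set \<Rightarrow> (('f, 'x) fm set \<times> ('f, 'x) fm) set
      \<Rightarrow> ('f, 'a) raw_structure \<Rightarrow> 'a set \<Rightarrow> bool" where
  "l_filter \<Sigma> X C A F \<longleftrightarrow> F \<subseteq> carrier A \<and>
     (\<forall>(\<Gamma>, \<phi>)\<in>C. \<forall>v\<in>str_hom \<Sigma> (Fm_alg \<Sigma> X) A. v ` \<Gamma> \<subseteq> F \<longrightarrow> v \<phi> \<in> F)"

section \<open>The category of presentable lattices\<close>

definition directed :: "'k rel \<Rightarrow> 'p gorder \<Rightarrow> 'p set \<Rightarrow> bool" where
  "directed \<kappa> L D \<longleftrightarrow> D \<subseteq> carrier L \<and> (\<forall>S\<subseteq>D. |S| <o \<kappa> \<longrightarrow> (\<exists>u\<in>D. \<forall>s\<in>S. s \<sqsubseteq>\<^bsub>L\<^esub> u))"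

definition small :: "'k rel \<Rightarrow> 'p gorder \<Rightarrow> 'p \<Rightarrow> bool" where
  "small \<kappa> L x \<longleftrightarrow> x \<in> carrier L \<and>
     (\<forall>D. directed \<kappa> L D \<longrightarrow> (x \<sqsubseteq>\<^bsub>L\<^esub> \<Squnion>\<^bsub>L\<^esub> D \<longleftrightarrow> (\<exists>d\<in>D. x \<sqsubseteq>\<^bsub>L\<^esub> d)))"

definition presentable_lattice :: "'k rel \<Rightarrow> 'p gorder \<Rightarrow> bool" where
  "presentable_lattice \<kappa> L \<longleftrightarrow> complete_lattice L \<and>
     (\<forall>x\<in>carrier L. \<exists>S\<subseteq>{s. small \<kappa> L s}. x = \<Squnion>\<^bsub>L\<^esub> S)"

definition order_maps :: "'p gorder \<Rightarrow> 'q gorder \<Rightarrow> ('p \<Rightarrow> 'q) set" where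
  "order_maps L L' = {f \<in> carrier L \<rightarrow>\<^sub>E carrier L'. isotone L L' f}"

definition preserves_infima :: "'p gorder \<Rightarrow> 'q gorder \<Rightarrow> ('p \<Rightarrow> 'q) \<Rightarrow> bool" where
  "preserves_infima L L' f \<longleftrightarrow> (\<forall>S\<subseteq>carrier L. f (\<Sqinter>\<^bsub>L\<^esub> S) = \<Sqinter>\<^bsub>L'\<^esub> (f ` S))"

definition preserves_directed_suprema ::
    "'k rel \<Rightarrow> 'p gorder \<Rightarrow> 'q gorder \<Rightarrow> ('p \<Rightarrow> 'q) \<Rightarrow> bool" where
  "preserves_directed_suprema \<kappa> L L' f \<longleftrightarrow>
     (\<forall>D. directed \<kappa> L D \<longrightarrow> f (\<Squnion>\<^bsub>L\<^esub> D) = \<Squnion>\<^bsub>L'\<^esub> (f ` D))"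

definition incl_order :: "'a set set \<Rightarrow> 'a set gorder" where
  "incl_order \<F> = \<lparr>carrier = \<F>, eq = (=), le = (\<subseteq>)\<rparr>"

section \<open>Filter pairs\<close>

text \<open>
  A contravariant functor from \<open>\<Sigma>\<close>-structures (with carrier in \<open>'a\<close>) to presentable lattices.
  As an extensional function does not determine its codomain, the action on morphisms is also given
  the domain \<open>M\<close> and codomain \<open>N\<close>: \<open>Gm M N h\<close> is the image of \<open>h : M \<rightarrow> N\<close>.
\<close>

locale str_functor =
  fixes \<kappa> :: "'k rel"
    and \<Sigma> :: "nat \<Rightarrow> 'f set"
    and G :: "('f, 'a) raw_structure \<Rightarrow> 'p gorder"
    and Gm :: "('f, 'a) raw_structure \<Rightarrow> ('f, 'a) raw_structure \<Rightarrow> ('a \<Rightarrow> 'a) \<Rightarrow> 'p \<Rightarrow> 'p"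
  assumes obj: "sig_structure \<Sigma> M \<Longrightarrow> presentable_lattice \<kappa> (G M)"
    and mor: "\<lbrakk>sig_structure \<Sigma> M; sig_structure \<Sigma> N; h \<in> str_hom \<Sigma> M N\<rbrakk>
                \<Longrightarrow> Gm M N h \<in> order_maps (G N) (G M)"
    and ident: "sig_structure \<Sigma> M \<Longrightarrow> Gm M M (\<lambda>a\<in>carrier M. a) = (\<lambda>p\<in>carrier (G M). p)"
    and comp: "\<lbrakk>sig_structure \<Sigma> M; sig_structure \<Sigma> N; sig_structure \<Sigma> P;
                h \<in> str_hom \<Sigma> M N; g \<in> str_hom \<Sigma> N P\<rbrakk>
                \<Longrightarrow> Gm M P (compose (carrier M) g h) = compose (carrier (G P)) (Gm M N h) (Gm N P g)"

locale filter_pair = str_functor \<kappa> \<Sigma> G Gm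
  for \<kappa> :: "'k rel"
    and \<Sigma> :: "nat \<Rightarrow> 'f set"
    and G :: "('f, 'a) raw_structure \<Rightarrow> 'p gorder"
    and Gm :: "('f, 'a) raw_structure \<Rightarrow> ('f, 'a) raw_structure \<Rightarrow> ('a \<Rightarrow> 'a) \<Rightarrow> 'p \<Rightarrow> 'p" +
  fixes i :: "('f, 'a) raw_structure \<Rightarrow> 'p \<Rightarrow> 'a set"
  assumes i_order_map:
      "sig_structure \<Sigma> M \<Longrightarrow> i M \<in> order_maps (G M) (incl_order (Pow (carrier M)))"
    and i_infima:
      "sig_structure \<Sigma> M \<Longrightarrow> preserves_infima (G M) (incl_order (Pow (carrier M))) (i M)"
    and i_directed_suprema:
      "sig_structure \<Sigma> M \<Longrightarrow>
        preserves_directed_suprema \<kappa> (G M) (incl_order (Pow (carrier M))) (i M)"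
    and i_natural:
      "\<lbrakk>sig_structure \<Sigma> M; sig_structure \<Sigma> N; h \<in> str_hom \<Sigma> M N; p \<in> carrier (G N)\<rbrakk>
        \<Longrightarrow> i M (Gm M N h p) = h -` (i N p) \<inter> carrier M"

section \<open>The filters of a logic\<close>

context
  fixes \<Sigma> :: "nat \<Rightarrow> 'f set"
    and X :: "'x set"
    and C :: "(('f, 'x) fm set \<times> ('f, 'x) fm) set"
begin

definition Fi :: "('f, 'a) raw_structure \<Rightarrow> 'a set gorder" where
  "Fi A = incl_order {F. l_filter \<Sigma> X C A F}"

definition Fi_map ::
    "('f, 'a) raw_structure \<Rightarrow> ('f, 'a) raw_structure \<Rightarrow> ('a \<Rightarrow> 'a) \<Rightarrow> 'a set \<Rightarrow> 'a set" where
  "Fi_map A' A h = (\<lambda>F\<in>carrier (Fi A). h -` F \<inter> carrier A')"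

definition Fi_incl :: "('f, 'a) raw_structure \<Rightarrow> 'a set \<Rightarrow> 'a set" where
  "Fi_incl A = (\<lambda>F\<in>carrier (Fi A). F)"

end

end

theory Submission
  imports Defs
begin

text \<open>
  If \<open>\<Gamma> \<turnstile> \<phi>\<close>, a directed union of filters containing \<open>v ` \<Gamma>\<close> has a member containing \<open>v ` \<Gamma>'\<close>
  for some \<open>\<Gamma>' \<subseteq> \<Gamma>\<close> of size \<open>< \<kappa>\<close> with \<open>\<Gamma>' \<turnstile> \<phi>\<close>. Hence the filters on a structure form a closure
  system that is closed under \<open>\<kappa>\<close>-directed unions. In such a system the closure of a singleton is
  \<open>\<kappa>\<close>-small, and every member is the supremum of the closures of its singletons.
\<close>

section \<open>Families of sets ordered by inclusion\<close>

lemma incl_order_simps [simp]: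
  "carrier (incl_order \<F>) = \<F>"
  "A \<sqsubseteq>\<^bsub>incl_order \<F>\<^esub> B \<longleftrightarrow> A \<subseteq> B"
  "A .=\<^bsub>incl_order \<F>\<^esub> B \<longleftrightarrow> A = B"
  by (simp_all add: incl_order_def)

lemma partial_order_incl_order: "partial_order (incl_order \<F>)"
  by unfold_locales (auto simp: fun_eq_iff)

text \<open>The supremum is defined by choice, so it can be computed only because antisymmetry of
  inclusion makes a least upper bound unique.\<close>

lemma sup_incl_order_eq:
  assumes "\<S> \<subseteq> \<F>" "U \<in> \<F>" "\<And>A. A \<in> \<S> \<Longrightarrow> A \<subseteq> U"
    and "\<And>B. B \<in> \<F> \<Longrightarrow> (\<And>A. A \<in> \<S> \<Longrightarrow> A \<subseteq> B) \<Longrightarrow> U \<subseteq> B"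
  shows "\<Squnion>\<^bsub>incl_order \<F>\<^esub> \<S> = U"
proof -
  have "Upper (incl_order \<F>) \<S> = {B \<in> \<F>. \<forall>A\<in>\<S>. A \<subseteq> B}"
    using assms(1) by (auto simp: Upper_def)
  then show ?thesis
    unfolding sup_def least_def
    by (intro some_equality) (simp_all add: assms(2,3,4) subset_antisym)
qed

lemma inf_incl_order_eq:
  assumes "\<S> \<subseteq> \<F>" "U \<in> \<F>" "\<And>A. A \<in> \<S> \<Longrightarrow> U \<subseteq> A"
    and "\<And>B. B \<in> \<F> \<Longrightarrow> (\<And>A. A \<in> \<S> \<Longrightarrow> B \<subseteq> A) \<Longrightarrow> B \<subseteq> U"
  shows "\<Sqinter>\<^bsub>incl_order \<F>\<^esub> \<S> = U"
proof -
  have "Lower (incl_order \<F>) \<S> = {B \<in> \<F>. \<forall>A\<in>\<S>. B \<subseteq> A}"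
    using assms(1) by (auto simp: Lower_def)
  then show ?thesis
    unfolding inf_def greatest_def
    by (intro some_equality) (simp_all add: assms(2,3,4) subset_antisym)
qed

section \<open>Directed families and closure systems\<close>

lemma directed_incl_orderD:
  assumes "directed \<kappa> (incl_order \<F>) \<D>" and "\<S> \<subseteq> \<D>" and "|\<S>| <o \<kappa>"
  obtains U where "U \<in> \<D>" "\<And>A. A \<in> \<S> \<Longrightarrow> A \<subseteq> U"
  using assms by (auto simp: directed_def)

text \<open>Choosing for each point of \<open>S\<close> a member of \<open>\<D>\<close> containing
  it gives a subfamily of size at most \<open>|S|\<close>; an upper bound of it in
  \<open>\<D>\<close> covers \<open>S\<close>.\<close>

lemma small_subset_directed_Union:
  assumes D: "directed \<kappa> (incl_order \<F>) \<D>" and "|S| <o \<kappa>" and "S \<subseteq> \<Union>\<D>"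
  obtains U where "U \<in> \<D>" "S \<subseteq> U"
proof -
  have "\<forall>x\<in>S. \<exists>A. A \<in> \<D> \<and> x \<in> A"
    using assms(3) by blast
  then obtain f where f: "\<forall>x\<in>S. f x \<in> \<D> \<and> x \<in> f x"
    by (rule bchoice[THEN exE])
  have "|f ` S| <o \<kappa>"
    using card_of_image assms(2) by (rule ordLeq_ordLess_trans)
  moreover have "f ` S \<subseteq> \<D>"
    using f by blast
  ultimately obtain U where "U \<in> \<D>" "\<And>A. A \<in> f ` S \<Longrightarrow> A \<subseteq> U"
    using directed_incl_orderD[OF D] by blast
  with f that show thesis by blast
qed

text \<open>Intersecting with \<open>U\<close> handles the empty family, whose bare intersection
  would be the whole type instead of the top element.\<close>

lemma inf_closure_system:
  assumes "\<And>\<S>. \<S> \<subseteq> \<F> \<Longrightarrow> U \<inter> \<Inter>\<S> \<in> \<F>" and "\<And>A. A \<in> \<F> \<Longrightarrow> A \<subseteq> U" and "\<S> \<subseteq> \<F>"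
  shows "\<Sqinter>\<^bsub>incl_order \<F>\<^esub> \<S> = U \<inter> \<Inter>\<S>"
  using assms by (intro inf_incl_order_eq) blast+

lemma complete_lattice_closure_system:
  assumes inter: "\<And>\<S>. \<S> \<subseteq> \<F> \<Longrightarrow> U \<inter> \<Inter>\<S> \<in> \<F>" and sub: "\<And>A. A \<in> \<F> \<Longrightarrow> A \<subseteq> U"
  shows "complete_lattice (incl_order \<F>)"
proof (rule partial_order.complete_lattice_criterion1[OF partial_order_incl_order])
  show "\<exists>g. greatest (incl_order \<F>) g (carrier (incl_order \<F>))"
    \<comment> \<open>The empty intersection yields \<open>U\<close> itself as the top
      element.\<close>
    using inter[of "{}"] sub by (auto simp: greatest_def)
next
  fix \<S>
  assume "\<S> \<subseteq> carrier (incl_order \<F>)"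
  then have "U \<inter> \<Inter>\<S> \<in> \<F>" and "\<S> \<subseteq> \<F>"
    using inter by simp_all
  then have "greatest (incl_order \<F>) (U \<inter> \<Inter>\<S>) (Lower (incl_order \<F>) \<S>)"
    using sub by (fastforce simp: greatest_def Lower_def)
  then show "\<exists>i. greatest (incl_order \<F>) i (Lower (incl_order \<F>) \<S>)" ..
qed

lemma sup_directed_Union:
  assumes "directed \<kappa> (incl_order \<F>) \<D>" and "\<Union>\<D> \<in> \<F>"
  shows "\<Squnion>\<^bsub>incl_order \<F>\<^esub> \<D> = \<Union>\<D>"
  using assms by (intro sup_incl_order_eq) (auto simp: directed_def)

lemma presentable_lattice_closure_system:
  assumes inter: "\<And>\<S>. \<S> \<subseteq> \<F> \<Longrightarrow> U \<inter> \<Inter>\<S> \<in> \<F>" and sub: "\<And>A. A \<in> \<F> \<Longrightarrow> A \<subseteq> U"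
    and union: "\<And>\<D>. directed \<kappa> (incl_order \<F>) \<D> \<Longrightarrow> \<Union>\<D> \<in> \<F>"
  shows "presentable_lattice \<kappa> (incl_order \<F>)"
  unfolding presentable_lattice_def
proof (intro conjI ballI)
  show "complete_lattice (incl_order \<F>)"
    using inter sub by (rule complete_lattice_closure_system)
  \<comment> \<open>\<open>cl x\<close> is the closure of \<open>{x}\<close> if
    \<open>x \<in> U\<close>. For \<open>x\<close> outside \<open>U\<close> no member contains
    \<open>x\<close>, and the value is \<open>U\<close>.\<close>
  define cl where "cl x = U \<inter> \<Inter>{A \<in> \<F>. x \<in> A}" for x
  have cl_in: "cl x \<in> \<F>" for x
    unfolding cl_def by (rule inter) auto
  have cl_sub: "cl x \<subseteq> A \<longleftrightarrow> x \<in> A" if "A \<in> \<F>" "x \<in> U" for x A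
    using that by (auto simp: cl_def)
  have cl_small: "small \<kappa> (incl_order \<F>) (cl x)" if "x \<in> U" for x
    unfolding small_def
  proof (intro conjI allI impI)
    fix \<D>
    assume D: "directed \<kappa> (incl_order \<F>) \<D>"
    then have "\<D> \<subseteq> \<F>"
      by (simp add: directed_def)
    \<comment> \<open>By \<open>cl_sub\<close>, lying above \<open>cl x\<close> means containing
      \<open>x\<close>. Since the supremum of \<open>\<D>\<close> is its union, smallness reduces to
      the definition of membership in a union.\<close>
    then have "(\<exists>A\<in>\<D>. cl x \<subseteq> A) \<longleftrightarrow> x \<in> \<Union>\<D>"
      using cl_sub that by blast
    then show "cl x \<sqsubseteq>\<^bsub>incl_order \<F>\<^esub> \<Squnion>\<^bsub>incl_order \<F>\<^esub> \<D> \<longleftrightarrow>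
        (\<exists>A\<in>\<D>. cl x \<sqsubseteq>\<^bsub>incl_order \<F>\<^esub> A)"
      by (simp add: sup_directed_Union[OF D union[OF D]] cl_sub[OF union[OF D] that])
  qed (simp add: cl_in)
  fix A
  assume "A \<in> carrier (incl_order \<F>)"
  then have A: "A \<in> \<F>" "A \<subseteq> U"
    using sub by auto
  have "\<Squnion>\<^bsub>incl_order \<F>\<^esub> (cl ` A) = A"
  proof (rule sup_incl_order_eq)
    show "B \<subseteq> A" if "B \<in> cl ` A" for B
      using that A cl_sub by blast
    show "A \<subseteq> B" if "B \<in> \<F>" "\<And>B'. B' \<in> cl ` A \<Longrightarrow> B' \<subseteq> B" for B
    proof
      fix x
      assume "x \<in> A"
      with that(2) have "cl x \<subseteq> B"
        by simp
      with that(1) \<open>x \<in> A\<close> A(2) show "x \<in> B"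
        using cl_sub by blast
    qed
  qed (use A cl_in in auto)
  moreover have "cl ` A \<subseteq> {s. small \<kappa> (incl_order \<F>) s}"
    using A cl_small by blast
  ultimately show "\<exists>S\<subseteq>{s. small \<kappa> (incl_order \<F>) s}. A = \<Squnion>\<^bsub>incl_order \<F>\<^esub> S"
    by metis
qed

section \<open>Homomorphisms\<close>

lemma str_hom_in: "h \<in> str_hom \<Sigma> M N \<Longrightarrow> a \<in> carrier M \<Longrightarrow> h a \<in> carrier N"
  unfolding str_hom_def by blast

lemma sig_structure_Fm_alg: "sig_structure \<Sigma> (Fm_alg \<Sigma> X)"
  by (auto simp: sig_structure_def Fm_alg_def intro: Fm.Op)

lemma str_hom_compose:
  assumes M: "sig_structure \<Sigma> M" and h: "h \<in> str_hom \<Sigma> M N" and g: "g \<in> str_hom \<Sigma> N P"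
  shows "compose (carrier M) g h \<in> str_hom \<Sigma> M P"
proof -
  have "compose (carrier M) g h (interp M f xs) = interp P f (map (compose (carrier M) g h) xs)"
    if f: "f \<in> \<Sigma> (length xs)" and xs: "set xs \<subseteq> carrier M" for f xs
  proof -
    \<comment> \<open>The extensional composite agrees with applying \<open>h\<close> and then
      \<open>g\<close> only on the carrier, so closure of \<open>M\<close> under the operations is
      used here.\<close>
    have "interp M f xs \<in> carrier M"
      using M f xs by (auto simp: sig_structure_def)
    \<comment> \<open>The homomorphism property of \<open>g\<close> is applied to the argument list
      \<open>map h xs\<close>; fusing the two maps is blocked to keep that list visible.\<close>
    moreover have "set (map h xs) \<subseteq> carrier N"
      using xs h by (auto intro: str_hom_in)
    then have "g (interp N f (map h xs)) = interp P f (map g (map h xs))"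
      using g f by (auto simp: str_hom_def simp del: set_map map_map)
    moreover have "h (interp M f xs) = interp N f (map h xs)"
      using h f xs by (auto simp: str_hom_def)
    moreover have "map (compose (carrier M) g h) xs = map g (map h xs)"
      using xs by (auto simp: compose_def)
    ultimately show ?thesis
      by (simp add: compose_eq del: map_map)
  qed
  moreover have "compose (carrier M) g h \<in> carrier M \<rightarrow>\<^sub>E carrier P"
    using str_hom_in[OF h] str_hom_in[OF g] by (simp add: compose_def restrict_PiE_iff)
  ultimately show ?thesis
    unfolding str_hom_def by blast
qed

section \<open>Filters\<close>

context logic
begin

lemma l_filter_carrier: "l_filter \<Sigma> X C A F \<Longrightarrow> F \<subseteq> carrier A"
  by (simp add: l_filter_def)

lemma l_filterD:
  assumes "l_filter \<Sigma> X C A F" "(\<Gamma>, \<phi>) \<in> C" "v \<in> str_hom \<Sigma> (Fm_alg \<Sigma> X) A" "v ` \<Gamma> \<subseteq> F"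
  shows "v \<phi> \<in> F"
  using assms unfolding l_filter_def by blast

lemma consequence_carrier:
  assumes "(\<Gamma>, \<phi>) \<in> C"
  shows "\<Gamma> \<subseteq> carrier (Fm_alg \<Sigma> X)" "\<phi> \<in> carrier (Fm_alg \<Sigma> X)"
  using assms consequence by (auto simp: Fm_alg_def)

lemma l_filter_Inter:
  assumes "\<And>F. F \<in> \<S> \<Longrightarrow> l_filter \<Sigma> X C A F"
  shows "l_filter \<Sigma> X C A (carrier A \<inter> \<Inter>\<S>)"
  unfolding l_filter_def
proof (intro conjI ballI, goal_cases)
  case (2 p)
  then obtain \<Gamma> \<phi> where p: "p = (\<Gamma>, \<phi>)" "(\<Gamma>, \<phi>) \<in> C"
    by (cases p) auto
  show ?case
    unfolding p prod.case
  proof (intro ballI impI)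
    fix v
    assume v: "v \<in> str_hom \<Sigma> (Fm_alg \<Sigma> X) A" and sub: "v ` \<Gamma> \<subseteq> carrier A \<inter> \<Inter>\<S>"
    have "v \<phi> \<in> F" if "F \<in> \<S>" for F
      using l_filterD[OF assms[OF that] p(2) v] sub that by blast
    \<comment> \<open>Membership in \<open>carrier A\<close> comes from \<open>v\<close> being a
      homomorphism, which also covers empty \<open>\<S>\<close>.\<close>
    then show "v \<phi> \<in> carrier A \<inter> \<Inter>\<S>"
      using str_hom_in[OF v consequence_carrier(2)[OF p(2)]] by blast
  qed
qed simp

lemma l_filter_directed_Union:
  assumes "logic_card_le \<kappa> C" and D: "directed \<kappa> (Fi \<Sigma> X C A) \<D>"
  shows "l_filter \<Sigma> X C A (\<Union>\<D>)"
proof -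
  have filters: "l_filter \<Sigma> X C A F" if "F \<in> \<D>" for F
    using D that by (auto simp: directed_def Fi_def)
  have "v \<phi> \<in> \<Union>\<D>"
    if "(\<Gamma>, \<phi>) \<in> C" and v: "v \<in> str_hom \<Sigma> (Fm_alg \<Sigma> X) A" and sub: "v ` \<Gamma> \<subseteq> \<Union>\<D>" for \<Gamma> \<phi> v
  proof -
    from assms(1) that(1) obtain \<Gamma>' where \<Gamma>': "\<Gamma>' \<subseteq> \<Gamma>" "|\<Gamma>'| <o \<kappa>" "(\<Gamma>', \<phi>) \<in> C"
      unfolding logic_card_le_def by blast
    have "|v ` \<Gamma>'| <o \<kappa>"
      using card_of_image \<Gamma>'(2) by (rule ordLeq_ordLess_trans)
    moreover have "v ` \<Gamma>' \<subseteq> \<Union>\<D>"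
      using \<Gamma>'(1) sub by blast
    ultimately obtain F where "F \<in> \<D>" "v ` \<Gamma>' \<subseteq> F"
      using small_subset_directed_Union[OF D[unfolded Fi_def]] by blast
    with filters \<Gamma>'(3) v show ?thesis
      by (blast dest: l_filterD)
  qed
  then show ?thesis
    using l_filter_carrier[OF filters] unfolding l_filter_def by blast
qed

text \<open>A valuation \<open>v\<close> in \<open>A'\<close> followed by \<open>h\<close> is a
  valuation in \<open>A\<close>, so the filter condition for \<open>F\<close> at the composite is
  the one for the preimage at \<open>v\<close>.\<close>

lemma l_filter_vimage:
  assumes h: "h \<in> str_hom \<Sigma> A' A" and F: "l_filter \<Sigma> X C A F"
  shows "l_filter \<Sigma> X C A' (h -` F \<inter> carrier A')"
proof -
  have "v \<phi> \<in> h -` F \<inter> carrier A'"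
    if c: "(\<Gamma>, \<phi>) \<in> C" and v: "v \<in> str_hom \<Sigma> (Fm_alg \<Sigma> X) A'"
      and sub: "v ` \<Gamma> \<subseteq> h -` F \<inter> carrier A'" for \<Gamma> \<phi> v
  proof -
    let ?w = "compose (carrier (Fm_alg \<Sigma> X)) h v"
    have w: "?w \<in> str_hom \<Sigma> (Fm_alg \<Sigma> X) A"
      using sig_structure_Fm_alg v h by (rule str_hom_compose)
    \<comment> \<open>The premises are formulas over \<open>\<Sigma>\<close> and \<open>X\<close>,
      so the restricted composite takes the value \<open>h (v \<psi>)\<close> at each premise
      \<open>\<psi>\<close>.\<close>
    have "?w ` \<Gamma> \<subseteq> F"
      using sub consequence_carrier(1)[OF c] by (fastforce simp: compose_eq)
    with F c w have "?w \<phi> \<in> F"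
      by (rule l_filterD)
    then show ?thesis
      using str_hom_in[OF v] consequence_carrier(2)[OF c] by (simp add: compose_eq)
  qed
  then show ?thesis
    unfolding l_filter_def by blast
qed

section \<open>The lattice of filters, its preimage maps and its inclusion\<close>

lemma carrier_Fi [simp]: "carrier (Fi \<Sigma> X C A) = {F. l_filter \<Sigma> X C A F}"
  by (simp add: Fi_def)

lemma le_Fi [simp]: "F \<sqsubseteq>\<^bsub>Fi \<Sigma> X C A\<^esub> F' \<longleftrightarrow> F \<subseteq> F'"
  by (simp add: Fi_def)

lemma partial_order_Fi: "partial_order (Fi \<Sigma> X C A)"
  unfolding Fi_def by (rule partial_order_incl_order)

lemma inf_Fi:
  assumes "\<S> \<subseteq> {F. l_filter \<Sigma> X C A F}"
  shows "\<Sqinter>\<^bsub>Fi \<Sigma> X C A\<^esub> \<S> = carrier A \<inter> \<Inter>\<S>"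
  unfolding Fi_def using assms
  by (intro inf_closure_system) (auto intro: l_filter_Inter dest: l_filter_carrier)

lemma presentable_lattice_Fi:
  assumes "logic_card_le \<kappa> C"
  shows "presentable_lattice \<kappa> (Fi \<Sigma> X C A)"
  unfolding Fi_def
proof (rule presentable_lattice_closure_system)
  show "carrier A \<inter> \<Inter>\<S> \<in> {F. l_filter \<Sigma> X C A F}" if "\<S> \<subseteq> {F. l_filter \<Sigma> X C A F}" for \<S>
    using that by (auto intro: l_filter_Inter)
  show "\<Union>\<D> \<in> {F. l_filter \<Sigma> X C A F}" if "directed \<kappa> (incl_order {F. l_filter \<Sigma> X C A F}) \<D>" for \<D>
    using that l_filter_directed_Union[OF assms] by (simp add: Fi_def)
qed (auto dest: l_filter_carrier)

lemma Fi_map_order_map: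
  assumes "h \<in> str_hom \<Sigma> M N"
  shows "Fi_map \<Sigma> X C M N h \<in> order_maps (Fi \<Sigma> X C N) (Fi \<Sigma> X C M)"
  \<comment> \<open>\<open>isotone\<close> also demands that both orders be weak partial
    orders.\<close>
  using assms partial_order.axioms(1)[OF partial_order_Fi]
  by (auto simp: order_maps_def isotone_def Fi_map_def intro: l_filter_vimage)

text \<open>Iterated preimages agree with the preimage under the composite: \<open>h\<close> maps
  into \<open>carrier N\<close>, so the inner intersection with \<open>carrier N\<close> is
  absorbed.\<close>

lemma Fi_map_compose:
  assumes h: "h \<in> str_hom \<Sigma> M N" and "g \<in> str_hom \<Sigma> N P"
  shows "Fi_map \<Sigma> X C M P (compose (carrier M) g h) =
    compose (carrier (Fi \<Sigma> X C P)) (Fi_map \<Sigma> X C M N h) (Fi_map \<Sigma> X C N P g)"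
  using assms
  by (auto simp: Fi_map_def compose_def l_filter_vimage str_hom_in[OF h] intro!: restrict_ext)

lemma Fi_incl_order_map:
  "Fi_incl \<Sigma> X C M \<in> order_maps (Fi \<Sigma> X C M) (incl_order (Pow (carrier M)))"
  using l_filter_carrier
  by (auto simp: order_maps_def isotone_def Fi_incl_def partial_order.axioms(1)
      partial_order_Fi partial_order_incl_order)

text \<open>Infima of filters and of subsets are given by the same formula
  \<open>carrier M \<inter> \<Inter>\<S>\<close>, which is again a filter.\<close>

lemma Fi_incl_preserves_infima:
  "preserves_infima (Fi \<Sigma> X C M) (incl_order (Pow (carrier M))) (Fi_incl \<Sigma> X C M)"
  unfolding preserves_infima_def
proof (intro allI impI)
  fix \<S>
  assume "\<S> \<subseteq> carrier (Fi \<Sigma> X C M)"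
  then have S: "\<S> \<subseteq> {F. l_filter \<Sigma> X C M F}"
    by simp
  then have "Fi_incl \<Sigma> X C M ` \<S> = \<S>"
    by (force simp: Fi_incl_def)
  moreover have "\<Sqinter>\<^bsub>incl_order (Pow (carrier M))\<^esub> \<S> = carrier M \<inter> \<Inter>\<S>"
    by (rule inf_closure_system) (use S in \<open>auto dest: l_filter_carrier\<close>)
  moreover have "l_filter \<Sigma> X C M (carrier M \<inter> \<Inter>\<S>)"
    using S by (auto intro: l_filter_Inter)
  ultimately show "Fi_incl \<Sigma> X C M (\<Sqinter>\<^bsub>Fi \<Sigma> X C M\<^esub> \<S>) =
      \<Sqinter>\<^bsub>incl_order (Pow (carrier M))\<^esub> (Fi_incl \<Sigma> X C M ` \<S>)"
    using inf_Fi[OF S] by (simp add: Fi_incl_def)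
qed

text \<open>A directed union of filters is a filter, hence the supremum in both orders.\<close>

lemma Fi_incl_preserves_directed_suprema:
  assumes "logic_card_le \<kappa> C"
  shows "preserves_directed_suprema \<kappa> (Fi \<Sigma> X C M) (incl_order (Pow (carrier M)))
    (Fi_incl \<Sigma> X C M)"
  unfolding preserves_directed_suprema_def
proof (intro allI impI)
  fix \<D>
  assume D: "directed \<kappa> (Fi \<Sigma> X C M) \<D>"
  then have sub: "\<D> \<subseteq> {F. l_filter \<Sigma> X C M F}"
    by (simp add: directed_def)
  then have "Fi_incl \<Sigma> X C M ` \<D> = \<D>"
    by (force simp: Fi_incl_def)
  moreover have "\<Squnion>\<^bsub>incl_order (Pow (carrier M))\<^esub> \<D> = \<Union>\<D>"
    by (rule sup_incl_order_eq) (use sub in \<open>auto dest!: l_filter_carrier\<close>)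
  moreover have F: "l_filter \<Sigma> X C M (\<Union>\<D>)"
    using assms D by (rule l_filter_directed_Union)
  moreover have "\<Squnion>\<^bsub>Fi \<Sigma> X C M\<^esub> \<D> = \<Union>\<D>"
    using D F unfolding Fi_def by (intro sup_directed_Union) auto
  ultimately show "Fi_incl \<Sigma> X C M (\<Squnion>\<^bsub>Fi \<Sigma> X C M\<^esub> \<D>) =
      \<Squnion>\<^bsub>incl_order (Pow (carrier M))\<^esub> (Fi_incl \<Sigma> X C M ` \<D>)"
    by (simp add: Fi_incl_def)
qed

end

theorem theorem2p12:
  fixes \<kappa> :: "'k rel"
    and \<Sigma> :: "nat \<Rightarrow> 'f set"
    and X :: "'x set"
    and C :: "(('f, 'x) fm set \<times> ('f, 'x) fm) set"
  assumes "Card_order \<kappa>" and "cinfinite \<kappa>" and "regularCard \<kappa>"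
    and "logic \<Sigma> X C"
    and "logic_card_le \<kappa> C"
  shows "filter_pair \<kappa> \<Sigma>
           (Fi \<Sigma> X C :: ('f, 'a) raw_structure \<Rightarrow> 'a set gorder)
           (Fi_map \<Sigma> X C)
           (Fi_incl \<Sigma> X C)"
proof -
  interpret logic \<Sigma> X C by fact
  show ?thesis
  proof unfold_locales
    fix M :: "('f, 'a) raw_structure"
    show "Fi_map \<Sigma> X C M M (\<lambda>a\<in>carrier M. a) = (\<lambda>p\<in>carrier (Fi \<Sigma> X C M). p)"
      \<comment> \<open>A filter lies in \<open>carrier M\<close>, so its preimage under the
        identity is the filter itself.\<close>
      by (force simp: Fi_map_def fun_eq_iff dest: l_filter_carrier)
  next
    fix M N :: "('f, 'a) raw_structure" and h p
    assume "h \<in> str_hom \<Sigma> M N" and "p \<in> carrier (Fi \<Sigma> X C N)"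
    \<comment> \<open>Both \<open>p\<close> and its preimage are filters, and on filters the
      restricted inclusion is the identity.\<close>
    then show "Fi_incl \<Sigma> X C M (Fi_map \<Sigma> X C M N h p) =
        h -` (Fi_incl \<Sigma> X C N p) \<inter> carrier M"
      by (simp add: Fi_incl_def Fi_map_def l_filter_vimage)
  qed (simp_all add: assms presentable_lattice_Fi Fi_map_order_map Fi_map_compose
      Fi_incl_order_map Fi_incl_preserves_infima Fi_incl_preserves_directed_suprema
      del: carrier_Fi)
qed

end
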